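(* Let $f:R_{1}\rightarrow R_{2}$ be a ring homomorphism, $J$ an ideal of $R_{2}$, $M_{1}$ an $R_{1}$-module, $M_{2}$ an $R_{2}$-module (regarded as an $R_{1}$-module via $f$), and $\varphi:M_{1}\rightarrow M_{2}$ an $R_{1}$-module homomorphism. Consider the $(R_{1}\Join^{f}J)$-module $M_{1}\Join^{\varphi}JM_{2}$ and let $N_{1}$ be a submodule of $M_{1}$. Then: (1) $N_{1}\Join^{\varphi}JM_{2}$ is a prime submodule of $M_{1}\Join^{\varphi}JM_{2}$ if and only if $N_{1}$ is a prime submodule of $M_{1}$. (2) $N_{1}\Join^{\varphi}JM_{2}$ is a weakly prime submodule of $M_{1}\Join^{\varphi}JM_{2}$ if and only if $N_{1}$ is a weakly prime submodule of $M_{1}$ and, for all $r_{1}\in R_{1}$, $m_{1}\in M_{1}$ with $r_{1}m_{1}=0$ but $r_{1}\notin(N_{1}:_{R_{1}}M_{1})$ and $m_{1}\notin N_{1}$, we have $f(r_{1})m_{2}+j\varphi(m_{1})+jm_{2}=0$ for every $j\in J$ and $m_{2}\in JM_{2}$.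
   Context: Rings are commutative with non-zero identity and modules are unital. For a submodule $N$ of an $R$-module $M$, $(N:_{R}M)=\{r\in R: rM\subseteq N\}$. Amalgamation: $R_{1}\Join^{f}J=\{(r,f(r)+j):r\in R_{1},j\in J\}$, a subring of $R_{1}\times R_{2}$. $M_{1}\Join^{\varphi}JM_{2}=\{(m_{1},\varphi(m_{1})+m_{2}):m_{1}\in M_{1},m_{2}\in JM_{2}\}$ is an $(R_{1}\Join^{f}J)$-module with scalar product $(r,f(r)+j)(m_{1},\varphi(m_{1})+m_{2})=(rm_{1},\varphi(rm_{1})+f(r)m_{2}+j\varphi(m_{1})+jm_{2})$. For a submodule $N_{1}$ of $M_{1}$, $N_{1}\Join^{\varphi}JM_{2}=\{(m_{1},\varphi(m_{1})+m_{2})\in M_{1}\Join^{\varphi}JM_{2}:m_{1}\in N_{1}\}$. A proper submodule $N$ of an $R$-module $M$ is prime (respectively weakly prime) if for all $r\in R$, $m\in M$ with $rm\in N$ (respectively $0\neq rm\in N$), either $r\in(N:_{R}M)$ or $m\in N$. *)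

theory Defs
  imports "HOL-Algebra.Module" "HOL-Algebra.Subrings" "HOL-Algebra.Chinese_Remainder"
begin

definition mod_hom ::
    "('r, 'k) ring_scheme \<Rightarrow> ('r, 'a, 'm) module_scheme \<Rightarrow> ('r, 'b, 'n) module_scheme \<Rightarrow> ('a \<Rightarrow> 'b) set"
  where "mod_hom R M N =
    {h \<in> hom (add_monoid M) (add_monoid N).
       \<forall>r \<in> carrier R. \<forall>x \<in> carrier M. h (r \<odot>\<^bsub>M\<^esub> x) = r \<odot>\<^bsub>N\<^esub> h x}"

text \<open>An \<open>S\<close>-module seen as an \<open>R\<close>-module along \<open>f : R \<rightarrow> S\<close>. Record update cannot change
  the type of the scalars, so the record is rebuilt.\<close>

definition restrict_scalars :: "('r \<Rightarrow> 's) \<Rightarrow> ('s, 'a, 'm) module_scheme \<Rightarrow> ('r, 'a) module"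
  where "restrict_scalars f M =
    \<lparr>carrier = carrier M, mult = mult M, one = one M, zero = zero M, add = add M,
     smult = (\<lambda>r x. f r \<odot>\<^bsub>M\<^esub> x)\<rparr>"

text \<open>The submodule \<open>J M\<close>, i.e. all finite sums of products \<open>j x\<close>; for an ideal \<open>J\<close> the
  additive subgroup generated by these products is closed under scalars.\<close>

definition ideal_smult :: "'r set \<Rightarrow> ('r, 'a, 'm) module_scheme \<Rightarrow> 'a set"
  where "ideal_smult J M =
    generate (add_monoid M) {j \<odot>\<^bsub>M\<^esub> x | j x. j \<in> J \<and> x \<in> carrier M}"

definition residual :: "('r, 'k) ring_scheme \<Rightarrow> ('r, 'a, 'm) module_scheme \<Rightarrow> 'a set \<Rightarrow> 'r set"
  where "residual R M N = {r \<in> carrier R. \<forall>x \<in> carrier M. r \<odot>\<^bsub>M\<^esub> x \<in> N}"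

definition prime_submodule ::
    "('r, 'k) ring_scheme \<Rightarrow> ('r, 'a, 'm) module_scheme \<Rightarrow> 'a set \<Rightarrow> bool"
  where "prime_submodule R M N \<longleftrightarrow>
    submodule N R M \<and> N \<noteq> carrier M \<and>
    (\<forall>r \<in> carrier R. \<forall>x \<in> carrier M.
       r \<odot>\<^bsub>M\<^esub> x \<in> N \<longrightarrow> r \<in> residual R M N \<or> x \<in> N)"

definition weakly_prime_submodule ::
    "('r, 'k) ring_scheme \<Rightarrow> ('r, 'a, 'm) module_scheme \<Rightarrow> 'a set \<Rightarrow> bool"
  where "weakly_prime_submodule R M N \<longleftrightarrow>
    submodule N R M \<and> N \<noteq> carrier M \<and>
    (\<forall>r \<in> carrier R. \<forall>x \<in> carrier M.
       r \<odot>\<^bsub>M\<^esub> x \<noteq> \<zero>\<^bsub>M\<^esub> \<and> r \<odot>\<^bsub>M\<^esub> x \<in> N \<longrightarrow> r \<in> residual R M N \<or> x \<in> N)"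

definition amalg_ring ::
    "('a, 'k) ring_scheme \<Rightarrow> ('b, 'l) ring_scheme \<Rightarrow> ('a \<Rightarrow> 'b) \<Rightarrow> 'b set \<Rightarrow> ('a \<times> 'b) ring"
  where "amalg_ring R1 R2 f J =
    (RDirProd R1 R2)\<lparr>carrier := {(r, f r \<oplus>\<^bsub>R2\<^esub> j) | r j. r \<in> carrier R1 \<and> j \<in> J}\<rparr>"

text \<open>For a pair \<open>(r, s) = (r, f r + j)\<close> and a pair \<open>(x, y) = (x, \<phi> x + z)\<close>, the components
  \<open>j\<close> and \<open>z\<close> are recovered as \<open>s - f r\<close> and \<open>y - \<phi> x\<close>. The fields \<open>mult\<close> and \<open>one\<close>
  that a module record inherits from ring records carry no meaning for modules.\<close>

definition amalg_module ::
    "('b, 'l) ring_scheme \<Rightarrow> ('a \<Rightarrow> 'b) \<Rightarrow> 'b set \<Rightarrow>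
     ('a, 'c, 'm) module_scheme \<Rightarrow> ('b, 'd, 'n) module_scheme \<Rightarrow> ('c \<Rightarrow> 'd) \<Rightarrow>
     ('a \<times> 'b, 'c \<times> 'd) module"
  where "amalg_module R2 f J M1 M2 \<phi> =
    \<lparr>carrier = {(x, \<phi> x \<oplus>\<^bsub>M2\<^esub> z) | x z. x \<in> carrier M1 \<and> z \<in> ideal_smult J M2},
     mult = undefined, one = undefined,
     zero = (\<zero>\<^bsub>M1\<^esub>, \<zero>\<^bsub>M2\<^esub>),
     add = (\<lambda>(x, y) (x', y'). (x \<oplus>\<^bsub>M1\<^esub> x', y \<oplus>\<^bsub>M2\<^esub> y')),
     smult = (\<lambda>(r, s) (x, y).
       let j = s \<ominus>\<^bsub>R2\<^esub> f r; z = y \<ominus>\<^bsub>M2\<^esub> \<phi> x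
       in (r \<odot>\<^bsub>M1\<^esub> x,
           \<phi> (r \<odot>\<^bsub>M1\<^esub> x) \<oplus>\<^bsub>M2\<^esub> f r \<odot>\<^bsub>M2\<^esub> z \<oplus>\<^bsub>M2\<^esub> j \<odot>\<^bsub>M2\<^esub> \<phi> x \<oplus>\<^bsub>M2\<^esub> j \<odot>\<^bsub>M2\<^esub> z))\<rparr>"

definition amalg_submodule ::
    "('b, 'l) ring_scheme \<Rightarrow> ('a \<Rightarrow> 'b) \<Rightarrow> 'b set \<Rightarrow>
     ('a, 'c, 'm) module_scheme \<Rightarrow> ('b, 'd, 'n) module_scheme \<Rightarrow> ('c \<Rightarrow> 'd) \<Rightarrow>
     'c set \<Rightarrow> ('c \<times> 'd) set"
  where "amalg_submodule R2 f J M1 M2 \<phi> N1 =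
    {p \<in> carrier (amalg_module R2 f J M1 M2 \<phi>). fst p \<in> N1}"

locale amalgamation =
  R1: cring R1 + R2: cring R2 + M1: module R1 M1 + M2: module R2 M2 + J: ideal J R2
  for R1 :: "('a, 'k) ring_scheme" and R2 :: "('b, 'l) ring_scheme"
    and M1 :: "('a, 'c, 'm) module_scheme" and M2 :: "('b, 'd, 'n) module_scheme"
    and J :: "'b set" +
  fixes f :: "'a \<Rightarrow> 'b" and \<phi> :: "'c \<Rightarrow> 'd"
  assumes f_hom: "f \<in> ring_hom R1 R2"
    and \<phi>_hom: "\<phi> \<in> mod_hom R1 M1 (restrict_scalars f M2)"
begin

lemma f_closed [simp]: "r \<in> carrier R1 \<Longrightarrow> f r \<in> carrier R2"
  using f_hom by (rule ring_hom_closed)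

lemma \<phi>_closed [simp]: "x \<in> carrier M1 \<Longrightarrow> \<phi> x \<in> carrier M2"
  and \<phi>_add [simp]:
    "\<lbrakk>x \<in> carrier M1; y \<in> carrier M1\<rbrakk> \<Longrightarrow> \<phi> (x \<oplus>\<^bsub>M1\<^esub> y) = \<phi> x \<oplus>\<^bsub>M2\<^esub> \<phi> y"
  and \<phi>_smult [simp]:
    "\<lbrakk>r \<in> carrier R1; x \<in> carrier M1\<rbrakk> \<Longrightarrow> \<phi> (r \<odot>\<^bsub>M1\<^esub> x) = f r \<odot>\<^bsub>M2\<^esub> \<phi> x"
  using \<phi>_hom by (auto simp: mod_hom_def restrict_scalars_def hom_def)

lemma \<phi>_zero [simp]: "\<phi> \<zero>\<^bsub>M1\<^esub> = \<zero>\<^bsub>M2\<^esub>"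
  using \<phi>_add[of "\<zero>\<^bsub>M1\<^esub>" "\<zero>\<^bsub>M1\<^esub>"] by (simp del: \<phi>_add add: M2.add.l_cancel_one')

lemma submodule_ideal_smult: "submodule (ideal_smult J M2) R2 M2"
proof -
  let ?G = "{j \<odot>\<^bsub>M2\<^esub> x | j x. j \<in> J \<and> x \<in> carrier M2}"
  have G: "?G \<subseteq> carrier (add_monoid M2)" by auto
  have sub: "subgroup (ideal_smult J M2) (add_monoid M2)"
    unfolding ideal_smult_def by (rule M2.add.generate_is_subgroup) (use G in auto)
  have cl: "a \<odot>\<^bsub>M2\<^esub> y \<in> ideal_smult J M2"
    if a: "a \<in> carrier R2" and y: "y \<in> ideal_smult J M2" for a y
    using y unfolding ideal_smult_def
  proof (induction rule: generate.induct)
    case one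
    show ?case using a generate.one[of "add_monoid M2" ?G] by simp
  next
    case (incl h)
    then obtain j x where h: "h = j \<odot>\<^bsub>M2\<^esub> x" "j \<in> J" "x \<in> carrier M2" by auto
    have "a \<odot>\<^bsub>M2\<^esub> h = (a \<otimes>\<^bsub>R2\<^esub> j) \<odot>\<^bsub>M2\<^esub> x" using a h by (simp add: M2.smult_assoc1)
    moreover have "a \<otimes>\<^bsub>R2\<^esub> j \<in> J" using a h by (simp add: J.I_l_closed)
    ultimately show ?case using h by (intro generate.incl) auto
  next
    case (inv h)
    then obtain j x where h: "h = j \<odot>\<^bsub>M2\<^esub> x" "j \<in> J" "x \<in> carrier M2" by auto
    have "a \<odot>\<^bsub>M2\<^esub> (\<ominus>\<^bsub>M2\<^esub> h) = (a \<otimes>\<^bsub>R2\<^esub> j) \<odot>\<^bsub>M2\<^esub> (\<ominus>\<^bsub>M2\<^esub> x)"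
      using a h by (simp add: M2.smult_assoc1 M2.smult_r_minus)
    moreover have "a \<otimes>\<^bsub>R2\<^esub> j \<in> J" using a h by (simp add: J.I_l_closed)
    ultimately have "a \<odot>\<^bsub>M2\<^esub> (\<ominus>\<^bsub>M2\<^esub> h) \<in> generate (add_monoid M2) ?G"
      using h by (intro generate.incl) auto
    then show ?case by (simp add: a_inv_def)
  next
    case (eng h1 h2)
    have "h1 \<in> carrier M2" "h2 \<in> carrier M2"
      using eng M2.add.generate_incl[of ?G] G by auto
    then show ?case using generate.eng[OF eng.IH] a by (simp add: M2.smult_r_distr)
  qed
  show ?thesis using sub cl by (simp add: submodule_def submodule_axioms_def)
qed

lemma ideal_smult_closed: "z \<in> ideal_smult J M2 \<Longrightarrow> z \<in> carrier M2"
  using M2.submoduleE(1)[OF submodule_ideal_smult] by blast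

lemma amalg_ring_carrier_iff:
  "(r, s) \<in> carrier (amalg_ring R1 R2 f J) \<longleftrightarrow>
     r \<in> carrier R1 \<and> s \<in> carrier R2 \<and> s \<ominus>\<^bsub>R2\<^esub> f r \<in> J"
proof -
  have "s = f r \<oplus>\<^bsub>R2\<^esub> (s \<ominus>\<^bsub>R2\<^esub> f r)" if "r \<in> carrier R1" "s \<in> carrier R2"
    using that f_closed[of r] by algebra
  moreover have "(f r \<oplus>\<^bsub>R2\<^esub> j) \<ominus>\<^bsub>R2\<^esub> f r = j" if "r \<in> carrier R1" "j \<in> J" for j
    using J.Icarr[OF that(2)] f_closed[OF that(1)] by algebra
  ultimately show ?thesis
    by (auto simp: amalg_ring_def J.Icarr)
qed

lemma amalg_module_carrier_iff:
  "(x, y) \<in> carrier (amalg_module R2 f J M1 M2 \<phi>) \<longleftrightarrow>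
     x \<in> carrier M1 \<and> y \<in> carrier M2 \<and> y \<ominus>\<^bsub>M2\<^esub> \<phi> x \<in> ideal_smult J M2"
proof -
  have "y = \<phi> x \<oplus>\<^bsub>M2\<^esub> (y \<ominus>\<^bsub>M2\<^esub> \<phi> x)" if "x \<in> carrier M1" "y \<in> carrier M2"
    using that by (simp add: a_minus_def M2.a_lcomm M2.r_neg)
  moreover have "(\<phi> x \<oplus>\<^bsub>M2\<^esub> z) \<ominus>\<^bsub>M2\<^esub> \<phi> x = z" if "x \<in> carrier M1" "z \<in> ideal_smult J M2" for z
    using ideal_smult_closed[OF that(2)] that(1)
    by (simp add: a_minus_def M2.a_comm[of "\<phi> x"] M2.a_assoc M2.r_neg)
  ultimately show ?thesis
    by (auto simp: amalg_module_def ideal_smult_closed)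
qed

lemma amalg_smult_eq:
  assumes "(r, s) \<in> carrier (amalg_ring R1 R2 f J)"
    and "(x, y) \<in> carrier (amalg_module R2 f J M1 M2 \<phi>)"
  shows "(r, s) \<odot>\<^bsub>amalg_module R2 f J M1 M2 \<phi>\<^esub> (x, y) = (r \<odot>\<^bsub>M1\<^esub> x, s \<odot>\<^bsub>M2\<^esub> y)"
proof -
  have c: "r \<in> carrier R1" "s \<in> carrier R2" "x \<in> carrier M1" "y \<in> carrier M2"
    using assms by (auto simp: amalg_ring_carrier_iff amalg_module_carrier_iff)
  define j where "j = s \<ominus>\<^bsub>R2\<^esub> f r"
  define z where "z = y \<ominus>\<^bsub>M2\<^esub> \<phi> x"
  have jz: "j \<in> carrier R2" "z \<in> carrier M2" using c by (auto simp: j_def z_def)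
  have s: "s = f r \<oplus>\<^bsub>R2\<^esub> j"
    unfolding j_def using c f_closed[of r] by algebra
  have y: "y = \<phi> x \<oplus>\<^bsub>M2\<^esub> z"
    unfolding z_def using c by (simp add: a_minus_def M2.a_lcomm M2.r_neg)
  have "s \<odot>\<^bsub>M2\<^esub> y = \<phi> (r \<odot>\<^bsub>M1\<^esub> x) \<oplus>\<^bsub>M2\<^esub> f r \<odot>\<^bsub>M2\<^esub> z \<oplus>\<^bsub>M2\<^esub> j \<odot>\<^bsub>M2\<^esub> \<phi> x \<oplus>\<^bsub>M2\<^esub> j \<odot>\<^bsub>M2\<^esub> z"
    unfolding s y using c jz
    by (simp add: M2.smult_l_distr M2.smult_r_distr M2.a_ac)
  then show ?thesis by (simp add: amalg_module_def Let_def j_def z_def)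
qed

lemma ring_RDirProd: "ring (RDirProd R1 R2)"
  by (rule RDirProd_ring[OF R1.ring_axioms R2.ring_axioms])

lemma RDirProd_simps:
  "carrier (RDirProd R1 R2) = carrier R1 \<times> carrier R2"
  "(r, s) \<oplus>\<^bsub>RDirProd R1 R2\<^esub> (r', s') = (r \<oplus>\<^bsub>R1\<^esub> r', s \<oplus>\<^bsub>R2\<^esub> s')"
  "(r, s) \<otimes>\<^bsub>RDirProd R1 R2\<^esub> (r', s') = (r \<otimes>\<^bsub>R1\<^esub> r', s \<otimes>\<^bsub>R2\<^esub> s')"
  "\<zero>\<^bsub>RDirProd R1 R2\<^esub> = (\<zero>\<^bsub>R1\<^esub>, \<zero>\<^bsub>R2\<^esub>)"
  "\<one>\<^bsub>RDirProd R1 R2\<^esub> = (\<one>\<^bsub>R1\<^esub>, \<one>\<^bsub>R2\<^esub>)"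
  by (auto simp: RDirProd_def DirProd_def monoid.defs)

lemma RDirProd_a_inv:
  assumes "r \<in> carrier R1" "s \<in> carrier R2"
  shows "\<ominus>\<^bsub>RDirProd R1 R2\<^esub> (r, s) = (\<ominus>\<^bsub>R1\<^esub> r, \<ominus>\<^bsub>R2\<^esub> s)"
proof -
  interpret P: ring "RDirProd R1 R2" by (rule ring_RDirProd)
  show ?thesis
    by (rule P.minus_equality) (use assms in \<open>auto simp: RDirProd_simps R1.l_neg R2.l_neg\<close>)
qed

lemma subcring_amalg_ring: "subcring (carrier (amalg_ring R1 R2 f J)) (RDirProd R1 R2)"
proof -
  interpret P: ring "RDirProd R1 R2" by (rule ring_RDirProd)
  interpret f: ring_hom_ring R1 R2 f
    by (rule ring_hom_ringI2[OF R1.ring_axioms R2.ring_axioms f_hom])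
  have "subring (carrier (amalg_ring R1 R2 f J)) (RDirProd R1 R2)"
  proof (rule P.subringI)
    show "carrier (amalg_ring R1 R2 f J) \<subseteq> carrier (RDirProd R1 R2)"
      by (auto simp: amalg_ring_carrier_iff RDirProd_simps)
    show "\<one>\<^bsub>RDirProd R1 R2\<^esub> \<in> carrier (amalg_ring R1 R2 f J)"
      by (simp add: RDirProd_simps amalg_ring_carrier_iff a_minus_def R2.r_neg)
  next
    fix p assume "p \<in> carrier (amalg_ring R1 R2 f J)"
    then obtain r s where p: "p = (r, s)" "r \<in> carrier R1" "s \<in> carrier R2" "s \<ominus>\<^bsub>R2\<^esub> f r \<in> J"
      by (metis amalg_ring_carrier_iff surj_pair)
    have "\<ominus>\<^bsub>R2\<^esub> s \<ominus>\<^bsub>R2\<^esub> f (\<ominus>\<^bsub>R1\<^esub> r) = \<ominus>\<^bsub>R2\<^esub> (s \<ominus>\<^bsub>R2\<^esub> f r)"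
      using p by (simp add: a_minus_def R2.minus_add)
    then show "\<ominus>\<^bsub>RDirProd R1 R2\<^esub> p \<in> carrier (amalg_ring R1 R2 f J)"
      using p J.a_inv_closed by (simp add: RDirProd_a_inv amalg_ring_carrier_iff)
  next
    fix p q assume "p \<in> carrier (amalg_ring R1 R2 f J)" "q \<in> carrier (amalg_ring R1 R2 f J)"
    then obtain r s r' s' where p: "p = (r, s)" "r \<in> carrier R1" "s \<in> carrier R2" "s \<ominus>\<^bsub>R2\<^esub> f r \<in> J"
      and q: "q = (r', s')" "r' \<in> carrier R1" "s' \<in> carrier R2" "s' \<ominus>\<^bsub>R2\<^esub> f r' \<in> J"
      by (metis amalg_ring_carrier_iff surj_pair)
    have c: "f r \<in> carrier R2" "f r' \<in> carrier R2" using p q by auto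
    have "(s \<oplus>\<^bsub>R2\<^esub> s') \<ominus>\<^bsub>R2\<^esub> (f r \<oplus>\<^bsub>R2\<^esub> f r') = (s \<ominus>\<^bsub>R2\<^esub> f r) \<oplus>\<^bsub>R2\<^esub> (s' \<ominus>\<^bsub>R2\<^esub> f r')"
      using p q c by algebra
    then show "p \<oplus>\<^bsub>RDirProd R1 R2\<^esub> q \<in> carrier (amalg_ring R1 R2 f J)"
      using p q J.a_closed by (simp add: RDirProd_simps amalg_ring_carrier_iff)
    have "(s \<otimes>\<^bsub>R2\<^esub> s') \<ominus>\<^bsub>R2\<^esub> (f r \<otimes>\<^bsub>R2\<^esub> f r')
        = s' \<otimes>\<^bsub>R2\<^esub> (s \<ominus>\<^bsub>R2\<^esub> f r) \<oplus>\<^bsub>R2\<^esub> f r \<otimes>\<^bsub>R2\<^esub> (s' \<ominus>\<^bsub>R2\<^esub> f r')"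
      using p q c by algebra
    moreover have "\<dots> \<in> J"
      using p q c by (intro J.a_closed J.I_l_closed)
    ultimately show "p \<otimes>\<^bsub>RDirProd R1 R2\<^esub> q \<in> carrier (amalg_ring R1 R2 f J)"
      using p q by (simp add: RDirProd_simps amalg_ring_carrier_iff)
  qed
  then show ?thesis
    by (rule subcring.intro)
      (auto simp: subcring_axioms_def amalg_ring_carrier_iff RDirProd_simps R1.m_comm R2.m_comm)
qed

lemma amalg_ring_simps:
  "(r, s) \<oplus>\<^bsub>amalg_ring R1 R2 f J\<^esub> (r', s') = (r \<oplus>\<^bsub>R1\<^esub> r', s \<oplus>\<^bsub>R2\<^esub> s')"
  "(r, s) \<otimes>\<^bsub>amalg_ring R1 R2 f J\<^esub> (r', s') = (r \<otimes>\<^bsub>R1\<^esub> r', s \<otimes>\<^bsub>R2\<^esub> s')"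
  "\<zero>\<^bsub>amalg_ring R1 R2 f J\<^esub> = (\<zero>\<^bsub>R1\<^esub>, \<zero>\<^bsub>R2\<^esub>)"
  "\<one>\<^bsub>amalg_ring R1 R2 f J\<^esub> = (\<one>\<^bsub>R1\<^esub>, \<one>\<^bsub>R2\<^esub>)"
  by (simp_all add: amalg_ring_def RDirProd_simps)

lemma cring_amalg_ring: "cring (amalg_ring R1 R2 f J)"
proof -
  interpret P: ring "RDirProd R1 R2" by (rule ring_RDirProd)
  have "cring ((RDirProd R1 R2)\<lparr>carrier := carrier (amalg_ring R1 R2 f J)\<rparr>)"
    using P.subcring_iff[of "carrier (amalg_ring R1 R2 f J)"] subcring_amalg_ring
    by (metis subringE(1) subcring_def)
  then show ?thesis by (simp add: amalg_ring_def)
qed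

lemma amalg_module_simps:
  "(x, y) \<oplus>\<^bsub>amalg_module R2 f J M1 M2 \<phi>\<^esub> (x', y') = (x \<oplus>\<^bsub>M1\<^esub> x', y \<oplus>\<^bsub>M2\<^esub> y')"
  "\<zero>\<^bsub>amalg_module R2 f J M1 M2 \<phi>\<^esub> = (\<zero>\<^bsub>M1\<^esub>, \<zero>\<^bsub>M2\<^esub>)"
  by (simp_all add: amalg_module_def)

lemma \<phi>_neg:
  assumes "x \<in> carrier M1"
  shows "\<phi> (\<ominus>\<^bsub>M1\<^esub> x) = \<ominus>\<^bsub>M2\<^esub> \<phi> x"
proof (rule sym, rule M2.minus_equality)
  show "\<phi> (\<ominus>\<^bsub>M1\<^esub> x) \<oplus>\<^bsub>M2\<^esub> \<phi> x = \<zero>\<^bsub>M2\<^esub>"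
    using \<phi>_add[of "\<ominus>\<^bsub>M1\<^esub> x" x] assms by (simp del: \<phi>_add add: M1.l_neg)
qed (use assms in auto)

lemma amalg_module_zero_closed:
  "(\<zero>\<^bsub>M1\<^esub>, \<zero>\<^bsub>M2\<^esub>) \<in> carrier (amalg_module R2 f J M1 M2 \<phi>)"
  using submodule_ideal_smult subgroup.one_closed[of "ideal_smult J M2" "add_monoid M2"]
  by (simp add: amalg_module_carrier_iff a_minus_def M2.r_neg submodule_def)

lemma amalg_module_add_closed:
  assumes "(x, y) \<in> carrier (amalg_module R2 f J M1 M2 \<phi>)"
    and "(x', y') \<in> carrier (amalg_module R2 f J M1 M2 \<phi>)"
  shows "(x \<oplus>\<^bsub>M1\<^esub> x', y \<oplus>\<^bsub>M2\<^esub> y') \<in> carrier (amalg_module R2 f J M1 M2 \<phi>)"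
proof -
  have c: "x \<in> carrier M1" "y \<in> carrier M2" "x' \<in> carrier M1" "y' \<in> carrier M2"
    "y \<ominus>\<^bsub>M2\<^esub> \<phi> x \<in> ideal_smult J M2" "y' \<ominus>\<^bsub>M2\<^esub> \<phi> x' \<in> ideal_smult J M2"
    using assms by (auto simp: amalg_module_carrier_iff)
  have "(y \<oplus>\<^bsub>M2\<^esub> y') \<ominus>\<^bsub>M2\<^esub> (\<phi> x \<oplus>\<^bsub>M2\<^esub> \<phi> x')
      = (y \<ominus>\<^bsub>M2\<^esub> \<phi> x) \<oplus>\<^bsub>M2\<^esub> (y' \<ominus>\<^bsub>M2\<^esub> \<phi> x')"
    using c by (simp add: a_minus_def M2.minus_add M2.a_ac)
  then show ?thesis
    using c M2.submoduleE(5)[OF submodule_ideal_smult] by (simp add: amalg_module_carrier_iff)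
qed

lemma amalg_module_neg_closed:
  assumes "(x, y) \<in> carrier (amalg_module R2 f J M1 M2 \<phi>)"
  shows "(\<ominus>\<^bsub>M1\<^esub> x, \<ominus>\<^bsub>M2\<^esub> y) \<in> carrier (amalg_module R2 f J M1 M2 \<phi>)"
proof -
  have c: "x \<in> carrier M1" "y \<in> carrier M2" "y \<ominus>\<^bsub>M2\<^esub> \<phi> x \<in> ideal_smult J M2"
    using assms by (auto simp: amalg_module_carrier_iff)
  have "\<ominus>\<^bsub>M2\<^esub> y \<ominus>\<^bsub>M2\<^esub> \<phi> (\<ominus>\<^bsub>M1\<^esub> x) = \<ominus>\<^bsub>M2\<^esub> (y \<ominus>\<^bsub>M2\<^esub> \<phi> x)"
    using c by (simp add: a_minus_def \<phi>_neg M2.minus_add)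
  then show ?thesis
    using c M2.submoduleE(3)[OF submodule_ideal_smult] by (simp add: amalg_module_carrier_iff)
qed

lemma amalg_module_smult_closed:
  assumes "(r, s) \<in> carrier (amalg_ring R1 R2 f J)"
    and "(x, y) \<in> carrier (amalg_module R2 f J M1 M2 \<phi>)"
  shows "(r \<odot>\<^bsub>M1\<^esub> x, s \<odot>\<^bsub>M2\<^esub> y) \<in> carrier (amalg_module R2 f J M1 M2 \<phi>)"
proof -
  have c: "r \<in> carrier R1" "s \<in> carrier R2" "s \<ominus>\<^bsub>R2\<^esub> f r \<in> J"
    "x \<in> carrier M1" "y \<in> carrier M2" "y \<ominus>\<^bsub>M2\<^esub> \<phi> x \<in> ideal_smult J M2"
    using assms by (auto simp: amalg_ring_carrier_iff amalg_module_carrier_iff)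
  have "(s \<ominus>\<^bsub>R2\<^esub> f r) \<odot>\<^bsub>M2\<^esub> y \<in> ideal_smult J M2"
    unfolding ideal_smult_def using c by (intro generate.incl) auto
  moreover have "f r \<odot>\<^bsub>M2\<^esub> (y \<ominus>\<^bsub>M2\<^esub> \<phi> x) \<in> ideal_smult J M2"
    using c M2.submoduleE(4)[OF submodule_ideal_smult] by simp
  moreover have "s \<odot>\<^bsub>M2\<^esub> y \<ominus>\<^bsub>M2\<^esub> f r \<odot>\<^bsub>M2\<^esub> \<phi> x
      = (s \<ominus>\<^bsub>R2\<^esub> f r) \<odot>\<^bsub>M2\<^esub> y \<oplus>\<^bsub>M2\<^esub> f r \<odot>\<^bsub>M2\<^esub> (y \<ominus>\<^bsub>M2\<^esub> \<phi> x)"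
    using c by (simp add: a_minus_def M2.smult_l_distr M2.smult_r_distr M2.smult_l_minus
        M2.smult_r_minus M2.a_assoc M2.r_neg2 M2.r_neg1)
  ultimately show ?thesis
    using c M2.submoduleE(5)[OF submodule_ideal_smult] by (simp add: amalg_module_carrier_iff)
qed

lemma module_amalg_module: "module (amalg_ring R1 R2 f J) (amalg_module R2 f J M1 M2 \<phi>)"
proof -
  let ?A = "amalg_ring R1 R2 f J" and ?M = "amalg_module R2 f J M1 M2 \<phi>"
  interpret A: cring ?A by (rule cring_amalg_ring)
  note iffs = amalg_ring_carrier_iff amalg_module_carrier_iff
  have ag: "abelian_group ?M"
  proof (rule abelian_groupI)
    fix p assume "p \<in> carrier ?M"
    then obtain x y where p: "p = (x, y)" "(x, y) \<in> carrier ?M" by (metis surj_pair)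
    then have "x \<in> carrier M1" "y \<in> carrier M2" by (auto simp: iffs)
    then have "(\<ominus>\<^bsub>M1\<^esub> x, \<ominus>\<^bsub>M2\<^esub> y) \<oplus>\<^bsub>?M\<^esub> p = \<zero>\<^bsub>?M\<^esub>"
      using p by (simp add: amalg_module_simps M1.l_neg M2.l_neg)
    then show "\<exists>q\<in>carrier ?M. q \<oplus>\<^bsub>?M\<^esub> p = \<zero>\<^bsub>?M\<^esub>"
      using amalg_module_neg_closed[OF p(2)] by blast
  next
    fix p q assume "p \<in> carrier ?M" "q \<in> carrier ?M"
    then show "p \<oplus>\<^bsub>?M\<^esub> q \<in> carrier ?M"
      by (cases p; cases q; simp add: amalg_module_simps amalg_module_add_closed)
  next
    show "\<zero>\<^bsub>?M\<^esub> \<in> carrier ?M"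
      by (simp add: amalg_module_simps amalg_module_zero_closed)
  qed (auto simp: amalg_module_simps iffs M1.a_ac M2.a_ac)
  show ?thesis
  proof (rule moduleI[OF cring_amalg_ring ag])
    fix a p assume "a \<in> carrier ?A" "p \<in> carrier ?M"
    then show "a \<odot>\<^bsub>?M\<^esub> p \<in> carrier ?M"
      by (cases a, cases p) (simp add: amalg_smult_eq amalg_module_smult_closed)
  next
    fix a b p assume h: "a \<in> carrier ?A" "b \<in> carrier ?A" "p \<in> carrier ?M"
    have "a \<oplus>\<^bsub>?A\<^esub> b \<in> carrier ?A" "a \<otimes>\<^bsub>?A\<^esub> b \<in> carrier ?A" using h by auto
    with h show "(a \<oplus>\<^bsub>?A\<^esub> b) \<odot>\<^bsub>?M\<^esub> p = a \<odot>\<^bsub>?M\<^esub> p \<oplus>\<^bsub>?M\<^esub> b \<odot>\<^bsub>?M\<^esub> p"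
      and "(a \<otimes>\<^bsub>?A\<^esub> b) \<odot>\<^bsub>?M\<^esub> p = a \<odot>\<^bsub>?M\<^esub> (b \<odot>\<^bsub>?M\<^esub> p)"
      by (cases a; cases b; cases p;
          simp add: amalg_ring_simps amalg_smult_eq amalg_module_smult_closed amalg_module_simps;
          simp add: iffs M1.smult_l_distr M2.smult_l_distr M1.smult_assoc1 M2.smult_assoc1)+
  next
    fix a p q assume h: "a \<in> carrier ?A" "p \<in> carrier ?M" "q \<in> carrier ?M"
    then show "a \<odot>\<^bsub>?M\<^esub> (p \<oplus>\<^bsub>?M\<^esub> q) = a \<odot>\<^bsub>?M\<^esub> p \<oplus>\<^bsub>?M\<^esub> a \<odot>\<^bsub>?M\<^esub> q"
      by (cases a; cases p; cases q;
          simp add: amalg_smult_eq amalg_module_add_closed amalg_module_simps;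
          simp add: iffs M1.smult_r_distr M2.smult_r_distr)
  next
    fix p assume h: "p \<in> carrier ?M"
    have "(\<one>\<^bsub>R1\<^esub>, \<one>\<^bsub>R2\<^esub>) \<in> carrier ?A"
      using A.one_closed by (simp add: amalg_ring_simps)
    with h show "\<one>\<^bsub>?A\<^esub> \<odot>\<^bsub>?M\<^esub> p = p"
      by (cases p; simp add: amalg_ring_simps amalg_smult_eq; simp add: iffs)
  qed
qed

lemma submodule_amalg_submodule:
  assumes "submodule N1 R1 M1"
  shows "submodule (amalg_submodule R2 f J M1 M2 \<phi> N1)
           (amalg_ring R1 R2 f J) (amalg_module R2 f J M1 M2 \<phi>)"
proof -
  let ?A = "amalg_ring R1 R2 f J" and ?M = "amalg_module R2 f J M1 M2 \<phi>"
  interpret A: module ?A ?M by (rule module_amalg_module)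
  note N = M1.submoduleE[OF assms]
  have zero: "\<zero>\<^bsub>M1\<^esub> \<in> N1"
    using subgroup.one_closed[of N1 "add_monoid M1"] assms by (simp add: submodule_def)
  show ?thesis
  proof (rule A.submoduleI)
    fix p assume "p \<in> amalg_submodule R2 f J M1 M2 \<phi> N1"
    then obtain x y where p: "p = (x, y)" "(x, y) \<in> carrier ?M" "x \<in> N1"
      by (cases p) (auto simp: amalg_submodule_def)
    have c: "x \<in> carrier M1" "y \<in> carrier M2" using p by (auto simp: amalg_module_carrier_iff)
    have "\<ominus>\<^bsub>?M\<^esub> p = (\<ominus>\<^bsub>M1\<^esub> x, \<ominus>\<^bsub>M2\<^esub> y)"
      by (rule A.M.minus_equality)
        (use p c amalg_module_neg_closed in \<open>auto simp: amalg_module_simps M1.l_neg M2.l_neg\<close>)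
    then show "\<ominus>\<^bsub>?M\<^esub> p \<in> amalg_submodule R2 f J M1 M2 \<phi> N1"
      using p N(3) amalg_module_neg_closed by (simp add: amalg_submodule_def)
  next
    fix a p assume h: "a \<in> carrier ?A" "p \<in> amalg_submodule R2 f J M1 M2 \<phi> N1"
    then show "a \<odot>\<^bsub>?M\<^esub> p \<in> amalg_submodule R2 f J M1 M2 \<phi> N1"
      using N(4) by (cases a; cases p) (auto simp: amalg_submodule_def amalg_smult_eq
          amalg_module_smult_closed amalg_ring_carrier_iff)
  qed (use N(5) zero in \<open>auto simp: amalg_submodule_def amalg_module_simps
         amalg_module_zero_closed amalg_module_add_closed\<close>)
qed

end

end

theory Submission
  imports Defs
begin

text \<open>
  Membership of a pair in the amalgamated submodule only looks at the first component, and a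
  product \<open>(r, s) (x, y)\<close> has first component \<open>r x\<close>. Since moreover every \<open>r\<close> and every \<open>x\<close>
  lift to the diagonal pairs \<open>(r, f r)\<close> and \<open>(x, \<phi> x)\<close>, the amalgamated submodule is the
  inverse image of \<open>N1\<close> under a surjection, so properness, the residual
  (\<open>residual_amalg_submodule_iff\<close>) and the conclusion of the prime condition translate literally
  between the two sides. This settles the prime case.

  For weak primeness the premise \<open>0 \<noteq> r x\<close> does not translate: the pair product may be
  nonzero although \<open>r x = 0\<close>, because of its second component. Writing \<open>s = f r + j\<close> and
  \<open>y = \<phi> x + z\<close>, the lemma \<open>amalg_smult_decomp\<close> shows that in the case \<open>r x = 0\<close> this second
  component is exactly \<open>f r z + j \<phi> x + j z\<close>. So what has to be demanded besides weak
  primeness of \<open>N1\<close> is that this expression vanishes whenever \<open>r x = 0\<close> with neither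
  \<open>r\<close> in the residual nor \<open>x\<close> in \<open>N1\<close>.
\<close>

context amalgamation
begin

abbreviation (input) "A \<equiv> amalg_ring R1 R2 f J"
abbreviation (input) "M \<equiv> amalg_module R2 f J M1 M2 \<phi>"
abbreviation (input) "amalg_sub N1 \<equiv> amalg_submodule R2 f J M1 M2 \<phi> N1"

lemma amalg_ring_decomp_closed:
  "\<lbrakk>r \<in> carrier R1; j \<in> J\<rbrakk> \<Longrightarrow> (r, f r \<oplus>\<^bsub>R2\<^esub> j) \<in> carrier A"
  by (auto simp: amalg_ring_def)

lemma amalg_module_decomp_closed:
  "\<lbrakk>x \<in> carrier M1; z \<in> ideal_smult J M2\<rbrakk> \<Longrightarrow> (x, \<phi> x \<oplus>\<^bsub>M2\<^esub> z) \<in> carrier M"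
  by (auto simp: amalg_module_def)

lemma amalg_ring_diag_closed: "r \<in> carrier R1 \<Longrightarrow> (r, f r) \<in> carrier A"
  using amalg_ring_decomp_closed[of r "\<zero>\<^bsub>R2\<^esub>"] by simp

lemma amalg_module_diag_closed: "x \<in> carrier M1 \<Longrightarrow> (x, \<phi> x) \<in> carrier M"
  using amalg_module_zero_closed amalg_module_decomp_closed[of x "\<zero>\<^bsub>M2\<^esub>"]
  by (simp add: amalg_module_carrier_iff a_minus_def M2.r_neg)

text \<open>The last three summands form the correction term of the weakly prime case: they are all
  that remains of the second component once \<open>r x = 0\<close>.\<close>

lemma amalg_smult_decomp:
  assumes "r \<in> carrier R1" "j \<in> J" "x \<in> carrier M1" "z \<in> ideal_smult J M2"
  shows "(r, f r \<oplus>\<^bsub>R2\<^esub> j) \<odot>\<^bsub>M\<^esub> (x, \<phi> x \<oplus>\<^bsub>M2\<^esub> z)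
    = (r \<odot>\<^bsub>M1\<^esub> x, \<phi> (r \<odot>\<^bsub>M1\<^esub> x) \<oplus>\<^bsub>M2\<^esub>
        (f r \<odot>\<^bsub>M2\<^esub> z \<oplus>\<^bsub>M2\<^esub> j \<odot>\<^bsub>M2\<^esub> \<phi> x \<oplus>\<^bsub>M2\<^esub> j \<odot>\<^bsub>M2\<^esub> z))"
proof -
  have "j \<in> carrier R2" "z \<in> carrier M2"
    using assms by (auto simp: J.Icarr ideal_smult_closed)
  then show ?thesis
    using assms
    unfolding amalg_smult_eq[OF amalg_ring_decomp_closed amalg_module_decomp_closed, OF assms]
    by (simp add: M2.smult_l_distr M2.smult_r_distr M2.a_ac)
qed

lemma mem_amalg_submodule_iff:
  "(x, y) \<in> carrier M \<Longrightarrow> (x, y) \<in> amalg_sub N1 \<longleftrightarrow> x \<in> N1"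
  by (simp add: amalg_submodule_def)

lemma smult_mem_amalg_submodule_iff:
  assumes "(r, s) \<in> carrier A" "(x, y) \<in> carrier M"
  shows "(r, s) \<odot>\<^bsub>M\<^esub> (x, y) \<in> amalg_sub N1 \<longleftrightarrow> r \<odot>\<^bsub>M1\<^esub> x \<in> N1"
  using assms
  by (simp add: amalg_smult_eq mem_amalg_submodule_iff amalg_module_smult_closed)

lemma amalg_submodule_eq_carrier_iff:
  assumes "N1 \<subseteq> carrier M1"
  shows "amalg_sub N1 = carrier M \<longleftrightarrow> N1 = carrier M1"
proof
  assume "amalg_sub N1 = carrier M"
  then show "N1 = carrier M1"
    using assms amalg_module_diag_closed mem_amalg_submodule_iff by blast
next
  assume "N1 = carrier M1"
  then show "amalg_sub N1 = carrier M"
    by (auto simp: amalg_submodule_def amalg_module_carrier_iff)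
qed

text \<open>The nontrivial direction tests \<open>(r, s)\<close> on the diagonal pairs \<open>(x, \<phi> x)\<close>, which reach
  every \<open>x\<close>.\<close>

lemma residual_amalg_submodule_iff:
  assumes "(r, s) \<in> carrier A"
  shows "(r, s) \<in> residual A M (amalg_sub N1) \<longleftrightarrow> r \<in> residual R1 M1 N1"
proof
  assume res: "(r, s) \<in> residual A M (amalg_sub N1)"
  have "r \<odot>\<^bsub>M1\<^esub> x \<in> N1" if "x \<in> carrier M1" for x
  proof -
    have d: "(x, \<phi> x) \<in> carrier M"
      using that by (rule amalg_module_diag_closed)
    then have "(r, s) \<odot>\<^bsub>M\<^esub> (x, \<phi> x) \<in> amalg_sub N1"
      using res by (simp add: residual_def)
    then show ?thesis
      using assms d by (simp add: smult_mem_amalg_submodule_iff)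
  qed
  then show "r \<in> residual R1 M1 N1"
    using assms by (simp add: residual_def amalg_ring_carrier_iff)
next
  assume res: "r \<in> residual R1 M1 N1"
  have "(r, s) \<odot>\<^bsub>M\<^esub> (x, y) \<in> amalg_sub N1" if "(x, y) \<in> carrier M" for x y
    using assms res that
    by (simp add: smult_mem_amalg_submodule_iff residual_def amalg_module_carrier_iff)
  then show "(r, s) \<in> residual A M (amalg_sub N1)"
    using assms by (auto simp: residual_def)
qed

theorem prime_amalg_submodule_iff:
  assumes N1: "submodule N1 R1 M1"
  shows "prime_submodule A M (amalg_sub N1) \<longleftrightarrow> prime_submodule R1 M1 N1"
    (is "?L \<longleftrightarrow> ?R")
proof
  note proper = amalg_submodule_eq_carrier_iff[OF M1.submoduleE(1)[OF N1]]
  {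
    assume L: ?L
    have "r \<in> residual R1 M1 N1 \<or> x \<in> N1"
      if h: "r \<in> carrier R1" "x \<in> carrier M1" "r \<odot>\<^bsub>M1\<^esub> x \<in> N1" for r x
    proof -
      note d = amalg_ring_diag_closed[OF h(1)] amalg_module_diag_closed[OF h(2)]
      have "(r, f r) \<odot>\<^bsub>M\<^esub> (x, \<phi> x) \<in> amalg_sub N1"
        using d h(3) by (simp add: smult_mem_amalg_submodule_iff)
      then have "(r, f r) \<in> residual A M (amalg_sub N1) \<or> (x, \<phi> x) \<in> amalg_sub N1"
        using L d unfolding prime_submodule_def by blast
      then show ?thesis
        using d by (simp add: residual_amalg_submodule_iff mem_amalg_submodule_iff)
    qed
    then show ?R
      using L N1 proper by (auto simp: prime_submodule_def)
  next
    assume R: ?R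
    have "(r, s) \<in> residual A M (amalg_sub N1) \<or> (x, y) \<in> amalg_sub N1"
      if h: "(r, s) \<in> carrier A" "(x, y) \<in> carrier M" "(r, s) \<odot>\<^bsub>M\<^esub> (x, y) \<in> amalg_sub N1"
      for r s x y
    proof -
      have "r \<in> carrier R1" "x \<in> carrier M1" "r \<odot>\<^bsub>M1\<^esub> x \<in> N1"
        using h by (auto simp: smult_mem_amalg_submodule_iff
            amalg_ring_carrier_iff amalg_module_carrier_iff)
      then have "r \<in> residual R1 M1 N1 \<or> x \<in> N1"
        using R unfolding prime_submodule_def by blast
      then show ?thesis
        using h by (simp add: residual_amalg_submodule_iff mem_amalg_submodule_iff)
    qed
    then show ?L
      using R submodule_amalg_submodule[OF N1] proper by (auto simp: prime_submodule_def)
  }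
qed

theorem weakly_prime_amalg_submodule_iff:
  assumes N1: "submodule N1 R1 M1"
  shows "weakly_prime_submodule A M (amalg_sub N1) \<longleftrightarrow>
    weakly_prime_submodule R1 M1 N1 \<and>
    (\<forall>r \<in> carrier R1. \<forall>x \<in> carrier M1.
       r \<odot>\<^bsub>M1\<^esub> x = \<zero>\<^bsub>M1\<^esub> \<and> r \<notin> residual R1 M1 N1 \<and> x \<notin> N1 \<longrightarrow>
       (\<forall>j \<in> J. \<forall>z \<in> ideal_smult J M2.
          f r \<odot>\<^bsub>M2\<^esub> z \<oplus>\<^bsub>M2\<^esub> j \<odot>\<^bsub>M2\<^esub> \<phi> x \<oplus>\<^bsub>M2\<^esub> j \<odot>\<^bsub>M2\<^esub> z = \<zero>\<^bsub>M2\<^esub>))"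
    (is "?L \<longleftrightarrow> ?W \<and> ?V")
proof
  note proper = amalg_submodule_eq_carrier_iff[OF M1.submoduleE(1)[OF N1]]
  note iffs = residual_amalg_submodule_iff mem_amalg_submodule_iff smult_mem_amalg_submodule_iff
  have zero_mem: "\<zero>\<^bsub>M1\<^esub> \<in> N1"
    using subgroup.one_closed[of N1 "add_monoid M1"] N1 by (simp add: submodule_def)
  have carr: "f r \<odot>\<^bsub>M2\<^esub> z \<oplus>\<^bsub>M2\<^esub> j \<odot>\<^bsub>M2\<^esub> \<phi> x \<oplus>\<^bsub>M2\<^esub> j \<odot>\<^bsub>M2\<^esub> z \<in> carrier M2"
    if "r \<in> carrier R1" "x \<in> carrier M1" "j \<in> J" "z \<in> ideal_smult J M2" for r x j z
    using that by (simp add: J.Icarr ideal_smult_closed)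
  {
    assume L: ?L
    have L': "r \<in> residual R1 M1 N1 \<or> x \<in> N1"
      if "(r, s) \<in> carrier A" "(x, y) \<in> carrier M" "r \<odot>\<^bsub>M1\<^esub> x \<in> N1"
        "(r, s) \<odot>\<^bsub>M\<^esub> (x, y) \<noteq> \<zero>\<^bsub>M\<^esub>" for r s x y
    proof -
      have "(r, s) \<odot>\<^bsub>M\<^esub> (x, y) \<in> amalg_sub N1"
        using that by (simp add: iffs)
      then have "(r, s) \<in> residual A M (amalg_sub N1) \<or> (x, y) \<in> amalg_sub N1"
        using L that unfolding weakly_prime_submodule_def by blast
      then show ?thesis
        using that by (simp add: iffs)
    qed
    have "r \<in> residual R1 M1 N1 \<or> x \<in> N1"
      if h: "r \<in> carrier R1" "x \<in> carrier M1" "r \<odot>\<^bsub>M1\<^esub> x \<noteq> \<zero>\<^bsub>M1\<^esub>" "r \<odot>\<^bsub>M1\<^esub> x \<in> N1" for r x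
    proof -
      note d = amalg_ring_diag_closed[OF h(1)] amalg_module_diag_closed[OF h(2)]
      show ?thesis
        using L'[OF d h(4)] h(3) d by (simp add: amalg_smult_eq amalg_module_simps)
    qed
    then have ?W
      using L N1 proper by (auto simp: weakly_prime_submodule_def)
    moreover have ?V
    proof (intro ballI impI, elim conjE)
      fix r x j z
      assume h: "r \<in> carrier R1" "x \<in> carrier M1" "j \<in> J" "z \<in> ideal_smult J M2"
        and rx: "r \<odot>\<^bsub>M1\<^esub> x = \<zero>\<^bsub>M1\<^esub>" and not: "r \<notin> residual R1 M1 N1" "x \<notin> N1"
      \<comment> \<open>The product of these two pairs lies in the amalgamated submodule, and neither factor
        does what the prime condition asks, so weak primeness forces the product to be zero.\<close>
      have "(r, f r \<oplus>\<^bsub>R2\<^esub> j) \<odot>\<^bsub>M\<^esub> (x, \<phi> x \<oplus>\<^bsub>M2\<^esub> z) = \<zero>\<^bsub>M\<^esub>"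
        using L'[OF amalg_ring_decomp_closed[OF h(1,3)] amalg_module_decomp_closed[OF h(2,4)]]
          rx not zero_mem by auto
      then show "f r \<odot>\<^bsub>M2\<^esub> z \<oplus>\<^bsub>M2\<^esub> j \<odot>\<^bsub>M2\<^esub> \<phi> x \<oplus>\<^bsub>M2\<^esub> j \<odot>\<^bsub>M2\<^esub> z = \<zero>\<^bsub>M2\<^esub>"
        using carr[OF h] unfolding amalg_smult_decomp[OF h(1,3,2,4)] rx
        by (simp add: amalg_module_simps)
    qed
    ultimately show "?W \<and> ?V" ..
  next
    assume R: "?W \<and> ?V"
    have "p \<in> residual A M (amalg_sub N1) \<or> q \<in> amalg_sub N1"
      if p: "p \<in> carrier A" and q: "q \<in> carrier M"
        and nz: "p \<odot>\<^bsub>M\<^esub> q \<noteq> \<zero>\<^bsub>M\<^esub>" and mem: "p \<odot>\<^bsub>M\<^esub> q \<in> amalg_sub N1" for p q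
    proof -
      obtain r j where rj: "p = (r, f r \<oplus>\<^bsub>R2\<^esub> j)" "r \<in> carrier R1" "j \<in> J"
        using p by (auto simp: amalg_ring_def)
      obtain x z where xz: "q = (x, \<phi> x \<oplus>\<^bsub>M2\<^esub> z)" "x \<in> carrier M1" "z \<in> ideal_smult J M2"
        using q by (auto simp: amalg_module_def)
      have rx: "r \<odot>\<^bsub>M1\<^esub> x \<in> N1"
        using mem p q unfolding rj(1) xz(1) by (simp add: iffs)
      have "r \<in> residual R1 M1 N1 \<or> x \<in> N1"
      proof (cases "r \<odot>\<^bsub>M1\<^esub> x = \<zero>\<^bsub>M1\<^esub>")
        case True
        \<comment> \<open>Here weak primeness of \<open>N1\<close> says nothing; but the product is nonzero, so its second
          component, the correction term, is nonzero.\<close>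
        have "f r \<odot>\<^bsub>M2\<^esub> z \<oplus>\<^bsub>M2\<^esub> j \<odot>\<^bsub>M2\<^esub> \<phi> x \<oplus>\<^bsub>M2\<^esub> j \<odot>\<^bsub>M2\<^esub> z \<noteq> \<zero>\<^bsub>M2\<^esub>"
          using nz carr[OF rj(2) xz(2) rj(3) xz(3)]
          unfolding rj(1) xz(1) amalg_smult_decomp[OF rj(2,3) xz(2,3)] True
          by (auto simp: amalg_module_simps)
        then show ?thesis
          using R rj(2,3) xz(2,3) True by blast
      next
        case False
        then show ?thesis
          using R rj(2) xz(2) rx unfolding weakly_prime_submodule_def by blast
      qed
      then show ?thesis
        using p q unfolding rj(1) xz(1) by (simp add: iffs)
    qed
    then show ?L
      using R submodule_amalg_submodule[OF N1] proper by (auto simp: weakly_prime_submodule_def)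
  }
qed

end

theorem corollary4:
  fixes R1 :: "('a, 'k) ring_scheme" and R2 :: "('b, 'l) ring_scheme"
    and M1 :: "('a, 'c, 'm) module_scheme" and M2 :: "('b, 'd, 'n) module_scheme"
    and f :: "'a \<Rightarrow> 'b" and \<phi> :: "'c \<Rightarrow> 'd" and J :: "'b set" and N1 :: "'c set"
  assumes "cring R1" and "\<one>\<^bsub>R1\<^esub> \<noteq> \<zero>\<^bsub>R1\<^esub>"
    and "cring R2" and "\<one>\<^bsub>R2\<^esub> \<noteq> \<zero>\<^bsub>R2\<^esub>"
    and "f \<in> ring_hom R1 R2"
    and "ideal J R2"
    and "module R1 M1" and "module R2 M2"
    and "\<phi> \<in> mod_hom R1 M1 (restrict_scalars f M2)"
    and "submodule N1 R1 M1"
  shows "(prime_submodule (amalg_ring R1 R2 f J) (amalg_module R2 f J M1 M2 \<phi>)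
            (amalg_submodule R2 f J M1 M2 \<phi> N1)
          \<longleftrightarrow> prime_submodule R1 M1 N1)
       \<and> (weakly_prime_submodule (amalg_ring R1 R2 f J) (amalg_module R2 f J M1 M2 \<phi>)
            (amalg_submodule R2 f J M1 M2 \<phi> N1)
          \<longleftrightarrow> weakly_prime_submodule R1 M1 N1 \<and>
              (\<forall>r1 \<in> carrier R1. \<forall>m1 \<in> carrier M1.
                 r1 \<odot>\<^bsub>M1\<^esub> m1 = \<zero>\<^bsub>M1\<^esub> \<and> r1 \<notin> residual R1 M1 N1 \<and> m1 \<notin> N1 \<longrightarrow>
                 (\<forall>j \<in> J. \<forall>m2 \<in> ideal_smult J M2.
                    f r1 \<odot>\<^bsub>M2\<^esub> m2 \<oplus>\<^bsub>M2\<^esub> j \<odot>\<^bsub>M2\<^esub> \<phi> m1 \<oplus>\<^bsub>M2\<^esub> j \<odot>\<^bsub>M2\<^esub> m2 = \<zero>\<^bsub>M2\<^esub>)))"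
proof -
  interpret amalgamation R1 R2 M1 M2 J f \<phi>
    using assms by (simp add: amalgamation_def amalgamation_axioms_def)
  show ?thesis
    using prime_amalg_submodule_iff[OF assms(10)] weakly_prime_amalg_submodule_iff[OF assms(10)]
    by (rule conjI)
qed

end
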